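(* Let $p_s\ge 0$ be an integer, let $S$ be a flat triangle lying in the element plane $\{z=0\}$ of the element frame, let $\mathbf r_p=(x_p,y_p,z_p)^T\in\mathbb{R}^3$, and let $j\in\{1,2,3\}$ be the index of an edge of $S$. Let $I$ be an interval of values of the edge coordinate $x^j$ along the line through edge $j$ such that the corresponding points of the line are all different from the projection $\check{\mathbf r}_p=(x_p,y_p,0)^T$. With the notation $i_m,k_m,\alpha_x,\alpha_y,\hat\alpha,\hat\beta,\gamma^2,\mathbf n^j,\mathbf{\hat i},\mathbf{\hat j}$, $r$ and the vector fields $\mathbf m_{b,c,a}$ of the context, define functions of $x^j\in I$ by the following two algorithms (all indices are nonnegative integers, and a term whose coefficient $b$ or $c$ is zero is omitted). **Algorithm 1** (computes $\kappa_{b,c,a}$ for $a+b+c\le p_s$): 1. $\kappa_{0,0,a}=i_a$ for all $a$. 2. $\kappa_{0,1,a}=\alpha_y\frac{r^{a+2}}{a+2}-\hat\beta\,\kappa_{0,0,a}$ for all $a$. 3. For $c=2,3,\dots,p_s$, all $\kappa_{0,c,a}$ from the case $b=0$ of $$\kappa_{b,c+2,a}=\alpha_y^2\kappa_{b,c,a+2}-2\hat\beta\,\kappa_{b,c+1,a}-(\hat\beta^2+\alpha_y^2\gamma^2)\kappa_{b,c,a}.$$ 4. $\kappa_{1,0,a}=\alpha_x\frac{r^{a+2}}{a+2}-\hat\alpha\,\kappa_{0,0,a}$ for all $a$. 5. For $b=2,3,\dots,p_s$, all $\kappa_{b,0,a}$ from the case $c=0$ of $$\kappa_{b+2,c,a}=\alpha_x^2\kappa_{b,c,a+2}-2\hat\alpha\,\kappa_{b+1,c,a}-(\hat\alpha^2+\alpha_x^2\gamma^2)\kappa_{b,c,a}.$$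 6. For $c=0,1,\dots,p_s-1$ and $b=0,1,\dots,p_s-c-1$, all remaining terms from $$\kappa_{b+1,c+1,a}=\alpha_x\alpha_y\kappa_{b,c,a+2}-\hat\beta\,\kappa_{b+1,c,a}-\hat\alpha\,\kappa_{b,c+1,a}-(\hat\alpha\hat\beta+\alpha_x\alpha_y\gamma^2)\kappa_{b,c,a}.$$ **Algorithm 2** (computes $\xi_{b,c,a}$ for $a+b+c\le p_s$): 1–2. $\xi_{0,0,a}=-\frac{k_{a+1}}{4\pi(a+1)}$ for $a=0$ and then for all $a$. 3. For $c=1,2,\dots,p_s$, all $\xi_{0,c,a}$ from the case $b=0$ of $$\xi_{b,c+1,a}=-\frac{c}{a+1}\xi_{b,c-1,a+2}+y_p\,\xi_{b,c,a}+\frac{\mathbf{\hat j}\cdot\mathbf n^j}{4\pi(a+1)}\kappa_{b,c,a+1}.$$ 4. For $c=0,1,\dots,p_s$ and $b=1,2,\dots,p_s-c$, all remaining terms from $$\xi_{b+1,c,a}=-\frac{b}{a+1}\xi_{b-1,c,a+2}+x_p\,\xi_{b,c,a}+\frac{\mathbf{\hat i}\cdot\mathbf n^j}{4\pi(a+1)}\kappa_{b,c,a+1}.$$ Then these algorithms evaluate the indefinite integrals needed for the single layer potential of the Laplace kernel with shape functions $x^by^c$: for all integers $b,c\ge0$ with $b+c\le p_s$, the field $\mathbf m_{b,c}:=\mathbf m_{b,c,0}$ satisfies $$\nabla_s\cdot\mathbf m_{b,c}=\frac{x^by^c}{4\pi r}$$ on the element plane with $\check{\mathbf r}_p$ removed,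 and $$\xi_{b,c,0}=\int \mathbf m_{b,c}\cdot\mathbf n^j\,dx^j,$$ i.e. $\xi_{b,c,0}$ is an antiderivative, with respect to $x^j\in I$, of the restriction of $\mathbf m_{b,c}\cdot\mathbf n^j$ to the line through edge $j$.
   Context: **Frames.** The element frame $(\mathbf{\hat i},\mathbf{\hat j},\mathbf{\hat k})$ is an orthonormal right-handed frame with origin in the plane of the triangle, $\mathbf{\hat k}$ being the unit normal of the triangle; coordinates are $(x,y,z)$, so the element plane is $z=0$. For edge $j$ the edge frame $(\mathbf{\hat i}^j,\mathbf{\hat j}^j,\mathbf{\hat k}^j)$ has $\mathbf{\hat i}^j$ the unit vector along the (oriented) edge, $\mathbf{\hat k}^j=\mathbf{\hat k}$, $\mathbf{\hat j}^j=\mathbf{\hat k}^j\times\mathbf{\hat i}^j=-\mathbf n^j$, where $\mathbf n^j$ is the outward unit normal of the edge in the element plane; its origin lies on the edge line, so $y^j=z^j=0$ on the edge line. The coordinates are related by $x=\alpha_xx^j+\beta_xy^j+\gamma_x$, $y=\alpha_yx^j+\beta_yy^j+\gamma_y$, $z=z^j$, where $(\alpha_x,\alpha_y)$ and $(\beta_x,\beta_y)$ are the element-frame components of $\mathbf{\hat i}^j$ and $\mathbf{\hat j}^j$. The edge-frame coordinates of $\mathbf r_p$ are $(x_p^j,y_p^j,z_p^j)$ with $z_p^j=z_p$. **Notation.** For a point $\mathbf r_q=(x,y,0)^T$ of the element plane, $r=|\mathbf r_q-\mathbf r_p|$, $\boldsymbol\rho=\mathbf r_q-\check{\mathbf r}_p$,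 $\rho=|\boldsymbol\rho|$. The surface divergence is $\nabla_s\cdot\mathbf m=\partial_xm_x+\partial_ym_y$. On the edge line: $x_d^j=x^j-x_p^j$, $\hat\alpha=-\gamma_x-\alpha_xx_p^j$, $\hat\beta=-\gamma_y-\alpha_yx_p^j$, $\gamma^2=r^2-(x_d^j)^2=(y_p^j)^2+(z_p^j)^2$. **Elementary integrals.** $i_m=\int r^m\,dx^j$ and $k_m=-y_p^j\int\frac{r^m}{\rho^2}\,dx^j$ denote antiderivatives in $x^j\in I$ (of the restrictions to the edge line), computed by $$i_{m+2}=\gamma^2\frac{m+2}{m+3}i_m+\frac{x_d^jr^{m+2}}{m+3},\qquad k_{m+2}=(z_p^j)^2k_m-y_p^ji_m,$$ from the initial terms $i_0=x_d^j$, $i_{-1}=\ln|r+x_d^j|$ (for $\gamma=0$: $i_{-1}=\operatorname{sgn}(x_d^j)\ln|x_d^j|$), and, for $y_p^j\ne0$, writing $s=-y_p^j/|y_p^j|$, $$k_0=s\arctan\frac{x_d^j}{|y_p^j|},\qquad k_1=s\,z_p^j\arctan\frac{z_p^jx_d^j}{|y_p^j|r}-y_p^j\ln|r+x_d^j|;$$ for $y_p^j=0$ all $k_m=0$. **Auxiliary vector fields.** On the element plane with $\check{\mathbf r}_p$ removed, for integers $a,b,c\ge0$, $a+b+c\le p_s$ (a term with coefficient $b=0$ or $c=0$ is omitted): $$\mathbf m_{0,0,a}=\frac{r^{a+1}}{4\pi(a+1)\rho^2}\boldsymbol\rho,$$ $$\mathbf m_{0,c+1,a}=-\frac{c}{a+1}\mathbf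 m_{0,c-1,a+2}+y_p\mathbf m_{0,c,a}+\frac{y^cr^{a+1}}{4\pi(a+1)}\mathbf{\hat j},$$ $$\mathbf m_{b+1,c,a}=-\frac{b}{a+1}\mathbf m_{b-1,c,a+2}+x_p\mathbf m_{b,c,a}+\frac{x^by^cr^{a+1}}{4\pi(a+1)}\mathbf{\hat i}.$$ **Role of the integrals.** The single layer potential of the Laplace kernel $\frac1{4\pi r}$ with density $x^by^c$ over $S$ is obtained from the divergence theorem as $\int_S\frac{x^by^c}{4\pi r}\,dS=\sum_{j=1}^3\int_{L_j}\mathbf n^j\cdot\mathbf m_{b,c}\,dL_j+T$, where $L_j$ is edge $j$ and $T$ is a correction term for the singularity of $\mathbf m_{b,c}$ at $\check{\mathbf r}_p$, present when $\check{\mathbf r}_p\in S$. This identity only explains the purpose of the integrals. *)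

theory Defs
  imports "HOL-Analysis.Analysis"
begin

text \<open>
  Points are given by their coordinates \<open>(x, y, z)\<close> in the element frame, so the frame vectors
  are the standard basis of \<open>real ^ 3\<close> and the element plane is \<open>z = 0\<close>.
\<close>

definition ihat :: "real ^ 3" where "ihat = axis 1 1"
definition jhat :: "real ^ 3" where "jhat = axis 2 1"
definition khat :: "real ^ 3" where "khat = axis 3 1"

definition element_plane :: "(real ^ 3) set" where
  "element_plane = {q. q $ 3 = 0}"

definition plane_proj :: "real ^ 3 \<Rightarrow> real ^ 3" where
  "plane_proj p = vector [p $ 1, p $ 2, 0]"


subsection \<open>Edge frames\<close>

record edge_frame =
  orig :: "real ^ 3"
  iv :: "real ^ 3"
  jv :: "real ^ 3"
  nv :: "real ^ 3"

definition outward_unit_normal ::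
    "(real ^ 3) set \<Rightarrow> real ^ 3 \<Rightarrow> real ^ 3 \<Rightarrow> real ^ 3 \<Rightarrow> bool" where
  "outward_unit_normal S u w n \<longleftrightarrow>
     norm n = 1 \<and> n \<bullet> khat = 0 \<and> n \<bullet> (w - u) = 0 \<and> (\<forall>q\<in>S. n \<bullet> (q - u) \<le> 0)"

text \<open>
  \<open>is_edge_frame S u w F\<close>: \<open>F\<close> is a frame for the edge of \<open>S\<close> joining \<open>u\<close> and \<open>w\<close>.  The
  orientation of the edge, i.e. the sign of \<open>l\<close>, is not prescribed by the order of the end points
  but fixed by the requirement that \<open>jv F\<close> is the inward normal.
\<close>

definition is_edge_frame ::
    "(real ^ 3) set \<Rightarrow> real ^ 3 \<Rightarrow> real ^ 3 \<Rightarrow> edge_frame \<Rightarrow> bool" where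
  "is_edge_frame S u w F \<longleftrightarrow>
     orig F \<in> affine hull {u, w} \<and>
     norm (iv F) = 1 \<and> (\<exists>l. w - u = l *\<^sub>R iv F) \<and>
     outward_unit_normal S u w (nv F) \<and>
     jv F = cross3 khat (iv F) \<and> jv F = - nv F"

definition edge_pt :: "edge_frame \<Rightarrow> real \<Rightarrow> real ^ 3" where
  "edge_pt F t = orig F + t *\<^sub>R iv F"

text \<open>
  In the following, \<open>p\<close> is the point \<open>r\<^sub>p\<close> and \<open>t\<close> is the edge coordinate \<open>x\<^sup>j\<close>.  The coefficients
  \<open>\<alpha>\<^sub>x, \<alpha>\<^sub>y\<close> are \<open>iv F $ 1, iv F $ 2\<close>, and \<open>\<gamma>\<^sub>x, \<gamma>\<^sub>y\<close> are \<open>orig F $ 1, orig F $ 2\<close>.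
\<close>

definition xpj :: "edge_frame \<Rightarrow> real ^ 3 \<Rightarrow> real" where
  "xpj F p = (p - orig F) \<bullet> iv F"
definition ypj :: "edge_frame \<Rightarrow> real ^ 3 \<Rightarrow> real" where
  "ypj F p = (p - orig F) \<bullet> jv F"
definition zpj :: "edge_frame \<Rightarrow> real ^ 3 \<Rightarrow> real" where
  "zpj F p = (p - orig F) \<bullet> khat"

definition xd :: "edge_frame \<Rightarrow> real ^ 3 \<Rightarrow> real \<Rightarrow> real" where
  "xd F p t = t - xpj F p"
definition redge :: "edge_frame \<Rightarrow> real ^ 3 \<Rightarrow> real \<Rightarrow> real" where
  "redge F p t = norm (edge_pt F t - p)"
definition alpha_hat :: "edge_frame \<Rightarrow> real ^ 3 \<Rightarrow> real" where
  "alpha_hat F p = - (orig F $ 1) - iv F $ 1 * xpj F p"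
definition beta_hat :: "edge_frame \<Rightarrow> real ^ 3 \<Rightarrow> real" where
  "beta_hat F p = - (orig F $ 2) - iv F $ 2 * xpj F p"
definition gamma_sq :: "edge_frame \<Rightarrow> real ^ 3 \<Rightarrow> real" where
  "gamma_sq F p = (ypj F p)\<^sup>2 + (zpj F p)\<^sup>2"


subsection \<open>Elementary integrals\<close>

definition i_minus1 :: "edge_frame \<Rightarrow> real ^ 3 \<Rightarrow> real \<Rightarrow> real" where
  "i_minus1 F p t =
     (if gamma_sq F p = 0 then sgn (xd F p t) * ln \<bar>xd F p t\<bar>
      else ln \<bar>redge F p t + xd F p t\<bar>)"

text \<open>The second equation is the instance \<open>m = -1\<close> of the recurrence in the third one.\<close>

fun i_int :: "edge_frame \<Rightarrow> real ^ 3 \<Rightarrow> nat \<Rightarrow> real \<Rightarrow> real" where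
  "i_int F p 0 t = xd F p t"
| "i_int F p (Suc 0) t =
     gamma_sq F p * (1 / 2) * i_minus1 F p t + xd F p t * redge F p t / 2"
| "i_int F p (Suc (Suc m)) t =
     gamma_sq F p * ((real m + 2) / (real m + 3)) * i_int F p m t
     + xd F p t * redge F p t ^ (m + 2) / (real m + 3)"

fun k_int :: "edge_frame \<Rightarrow> real ^ 3 \<Rightarrow> nat \<Rightarrow> real \<Rightarrow> real" where
  "k_int F p 0 t =
     (if ypj F p = 0 then 0
      else - (ypj F p / \<bar>ypj F p\<bar>) * arctan (xd F p t / \<bar>ypj F p\<bar>))"
| "k_int F p (Suc 0) t =
     (if ypj F p = 0 then 0
      else - (ypj F p / \<bar>ypj F p\<bar>) * zpj F p
             * arctan (zpj F p * xd F p t / (\<bar>ypj F p\<bar> * redge F p t))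
           - ypj F p * ln \<bar>redge F p t + xd F p t\<bar>)"
| "k_int F p (Suc (Suc m)) t =
     (if ypj F p = 0 then 0
      else (zpj F p)\<^sup>2 * k_int F p m t - ypj F p * i_int F p m t)"


subsection \<open>Auxiliary vector fields and the surface divergence\<close>

text \<open>
  Here and in the second algorithm, the truncated index \<open>c - 1\<close> (or \<open>b - 1\<close>) at \<open>c = 0\<close> (or \<open>b = 0\<close>)
  is harmless: the term has coefficient 0, i.e. it is omitted.
\<close>

fun mfield :: "real ^ 3 \<Rightarrow> nat \<Rightarrow> nat \<Rightarrow> nat \<Rightarrow> real ^ 3 \<Rightarrow> real ^ 3" where
  "mfield p 0 0 a q =
     (norm (q - p) ^ (a + 1) / (4 * pi * (real a + 1) * (norm (q - plane_proj p))\<^sup>2))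
       *\<^sub>R (q - plane_proj p)"
| "mfield p 0 (Suc c) a q =
     - (real c / (real a + 1)) *\<^sub>R mfield p 0 (c - 1) (a + 2) q
     + (p $ 2) *\<^sub>R mfield p 0 c a q
     + ((q $ 2) ^ c * norm (q - p) ^ (a + 1) / (4 * pi * (real a + 1))) *\<^sub>R jhat"
| "mfield p (Suc b) c a q =
     - (real b / (real a + 1)) *\<^sub>R mfield p (b - 1) c (a + 2) q
     + (p $ 1) *\<^sub>R mfield p b c a q
     + ((q $ 1) ^ b * (q $ 2) ^ c * norm (q - p) ^ (a + 1) / (4 * pi * (real a + 1))) *\<^sub>R ihat"

definition has_surface_divergence ::
    "(real ^ 3 \<Rightarrow> real ^ 3) \<Rightarrow> real \<Rightarrow> real ^ 3 \<Rightarrow> bool" where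
  "has_surface_divergence m d q \<longleftrightarrow>
     (\<exists>dx dy. ((\<lambda>h. m (q + h *\<^sub>R ihat) $ 1) has_real_derivative dx) (at 0) \<and>
              ((\<lambda>h. m (q + h *\<^sub>R jhat) $ 2) has_real_derivative dy) (at 0) \<and>
              d = dx + dy)"


subsection \<open>The two algorithms\<close>

text \<open>
  The algorithms are specified by the entries \<open>a + b + c \<le> ps\<close> they assign; entries outside this
  range are left arbitrary.
\<close>

definition algorithm1 ::
    "nat \<Rightarrow> edge_frame \<Rightarrow> real ^ 3 \<Rightarrow> real set \<Rightarrow> (nat \<Rightarrow> nat \<Rightarrow> nat \<Rightarrow> real \<Rightarrow> real) \<Rightarrow> bool" where
  "algorithm1 ps F p I \<kappa> \<longleftrightarrow> (\<forall>t\<in>I.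
     let ax = iv F $ 1; ay = iv F $ 2; ah = alpha_hat F p; bh = beta_hat F p;
         g2 = gamma_sq F p; r = redge F p t
     in
     (\<forall>a. a \<le> ps \<longrightarrow> \<kappa> 0 0 a t = i_int F p a t) \<and>
     (\<forall>a. a + 1 \<le> ps \<longrightarrow>
        \<kappa> 0 1 a t = ay * (r ^ (a + 2) / (real a + 2)) - bh * \<kappa> 0 0 a t) \<and>
     (\<forall>c a. a + (c + 2) \<le> ps \<longrightarrow>
        \<kappa> 0 (c + 2) a t =
          ay\<^sup>2 * \<kappa> 0 c (a + 2) t - 2 * bh * \<kappa> 0 (c + 1) a t
          - (bh\<^sup>2 + ay\<^sup>2 * g2) * \<kappa> 0 c a t) \<and>
     (\<forall>a. a + 1 \<le> ps \<longrightarrow>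
        \<kappa> 1 0 a t = ax * (r ^ (a + 2) / (real a + 2)) - ah * \<kappa> 0 0 a t) \<and>
     (\<forall>b a. a + (b + 2) \<le> ps \<longrightarrow>
        \<kappa> (b + 2) 0 a t =
          ax\<^sup>2 * \<kappa> b 0 (a + 2) t - 2 * ah * \<kappa> (b + 1) 0 a t
          - (ah\<^sup>2 + ax\<^sup>2 * g2) * \<kappa> b 0 a t) \<and>
     (\<forall>b c a. a + (b + 1) + (c + 1) \<le> ps \<longrightarrow>
        \<kappa> (b + 1) (c + 1) a t =
          ax * ay * \<kappa> b c (a + 2) t - bh * \<kappa> (b + 1) c a t - ah * \<kappa> b (c + 1) a t
          - (ah * bh + ax * ay * g2) * \<kappa> b c a t))"

definition algorithm2 ::
    "nat \<Rightarrow> edge_frame \<Rightarrow> real ^ 3 \<Rightarrow> real set \<Rightarrow> (nat \<Rightarrow> nat \<Rightarrow> nat \<Rightarrow> real \<Rightarrow> real) \<Rightarrow>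
     (nat \<Rightarrow> nat \<Rightarrow> nat \<Rightarrow> real \<Rightarrow> real) \<Rightarrow> bool" where
  "algorithm2 ps F p I \<kappa> \<xi> \<longleftrightarrow> (\<forall>t\<in>I.
     (\<forall>a. a \<le> ps \<longrightarrow> \<xi> 0 0 a t = - (k_int F p (a + 1) t / (4 * pi * (real a + 1)))) \<and>
     (\<forall>c a. a + (c + 1) \<le> ps \<longrightarrow>
        \<xi> 0 (c + 1) a t =
          - (real c / (real a + 1)) * \<xi> 0 (c - 1) (a + 2) t + p $ 2 * \<xi> 0 c a t
          + (jhat \<bullet> nv F) / (4 * pi * (real a + 1)) * \<kappa> 0 c (a + 1) t) \<and>
     (\<forall>b c a. a + (b + 1) + c \<le> ps \<longrightarrow>
        \<xi> (b + 1) c a t =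
          - (real b / (real a + 1)) * \<xi> (b - 1) c (a + 2) t + p $ 1 * \<xi> b c a t
          + (ihat \<bullet> nv F) / (4 * pi * (real a + 1)) * \<kappa> b c (a + 1) t))"


text \<open>The two specifications are satisfiable.\<close>

fun kappa :: "edge_frame \<Rightarrow> real ^ 3 \<Rightarrow> nat \<Rightarrow> nat \<Rightarrow> nat \<Rightarrow> real \<Rightarrow> real" where
  "kappa F p 0 0 a t = i_int F p a t"
| "kappa F p 0 (Suc 0) a t =
     iv F $ 2 * (redge F p t ^ (a + 2) / (real a + 2)) - beta_hat F p * kappa F p 0 0 a t"
| "kappa F p 0 (Suc (Suc c)) a t =
     (iv F $ 2)\<^sup>2 * kappa F p 0 c (a + 2) t - 2 * beta_hat F p * kappa F p 0 (Suc c) a t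
     - ((beta_hat F p)\<^sup>2 + (iv F $ 2)\<^sup>2 * gamma_sq F p) * kappa F p 0 c a t"
| "kappa F p (Suc 0) 0 a t =
     iv F $ 1 * (redge F p t ^ (a + 2) / (real a + 2)) - alpha_hat F p * kappa F p 0 0 a t"
| "kappa F p (Suc (Suc b)) 0 a t =
     (iv F $ 1)\<^sup>2 * kappa F p b 0 (a + 2) t - 2 * alpha_hat F p * kappa F p (Suc b) 0 a t
     - ((alpha_hat F p)\<^sup>2 + (iv F $ 1)\<^sup>2 * gamma_sq F p) * kappa F p b 0 a t"
| "kappa F p (Suc b) (Suc c) a t =
     iv F $ 1 * iv F $ 2 * kappa F p b c (a + 2) t
     - beta_hat F p * kappa F p (Suc b) c a t - alpha_hat F p * kappa F p b (Suc c) a t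
     - (alpha_hat F p * beta_hat F p + iv F $ 1 * iv F $ 2 * gamma_sq F p) * kappa F p b c a t"

fun xi :: "edge_frame \<Rightarrow> real ^ 3 \<Rightarrow> (nat \<Rightarrow> nat \<Rightarrow> nat \<Rightarrow> real \<Rightarrow> real) \<Rightarrow>
    nat \<Rightarrow> nat \<Rightarrow> nat \<Rightarrow> real \<Rightarrow> real" where
  "xi F p \<kappa> 0 0 a t = - (k_int F p (a + 1) t / (4 * pi * (real a + 1)))"
| "xi F p \<kappa> 0 (Suc c) a t =
     - (real c / (real a + 1)) * xi F p \<kappa> 0 (c - 1) (a + 2) t + p $ 2 * xi F p \<kappa> 0 c a t
     + (jhat \<bullet> nv F) / (4 * pi * (real a + 1)) * \<kappa> 0 c (a + 1) t"
| "xi F p \<kappa> (Suc b) c a t =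
     - (real b / (real a + 1)) * xi F p \<kappa> (b - 1) c (a + 2) t + p $ 1 * xi F p \<kappa> b c a t
     + (ihat \<bullet> nv F) / (4 * pi * (real a + 1)) * \<kappa> b c (a + 1) t"

lemma algorithm1_kappa: "algorithm1 ps F p I (kappa F p)"
  by (simp add: algorithm1_def Let_def)

lemma algorithm2_xi: "algorithm2 ps F p I \<kappa> (xi F p \<kappa>)"
  by (simp add: algorithm2_def)

end

theory Submission
  imports Defs
begin

text \<open>
  The divergence of the base field is a direct computation: \<open>\<rho> / |\<rho>|\<^sup>2\<close> is divergence free in the punctured
  plane, so only the gradient of \<open>r\<^sup>a\<^sup>+\<^sup>1\<close> contributes.  In the recursion the divergence of the term
  along a frame vector consists of the density wanted minus \<open>x\<^sub>p\<close> (or \<open>y\<^sub>p\<close>) times the previous density,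
  plus a lower order term; the other two summands cancel the unwanted parts.  On the edge line,
  \<open>x = \<alpha>\<^sub>x x\<^sub>d - \<alpha>\<^sub>h\<close>, \<open>y = \<alpha>\<^sub>y x\<^sub>d - \<beta>\<^sub>h\<close> and \<open>r\<^sup>2 = x\<^sub>d\<^sup>2 + \<gamma>\<^sup>2\<close>; eliminating \<open>x\<^sub>d\<close> expresses \<open>x\<^sup>2\<close>, \<open>y\<^sup>2\<close>, \<open>x y\<close>
  through \<open>x\<close>, \<open>y\<close>, \<open>r\<^sup>2\<close>, which is the recurrence of the first algorithm under the integral sign.
  The second algorithm is the recursion of the fields dotted with the normal.
\<close>

section \<open>Calculus tools in one variable\<close>

text \<open>Along a line the squared norm is a quadratic polynomial in the parameter, so the chain
  rule for the square root suffices; where the point is nonzero the radicand is positive.\<close>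

lemma has_real_derivative_norm_line:
  fixes w u :: "'a::real_inner"
  assumes "w + t *\<^sub>R u \<noteq> 0"
  shows "((\<lambda>h. norm (w + h *\<^sub>R u)) has_real_derivative
           ((w + t *\<^sub>R u) \<bullet> u / norm (w + t *\<^sub>R u))) (at t within A)"
proof -
  have eq: "norm (w + h *\<^sub>R u) = sqrt (w \<bullet> w + 2 * h * (w \<bullet> u) + h\<^sup>2 * (u \<bullet> u))" for h
    by (simp add: norm_eq_sqrt_inner inner_simps inner_commute power2_eq_square algebra_simps)
  have "w \<bullet> w + 2 * t * (w \<bullet> u) + t\<^sup>2 * (u \<bullet> u) > 0"
    using assms zero_less_norm_iff[of "w + t *\<^sub>R u"] unfolding eq by simp
  then have "((\<lambda>h. sqrt (w \<bullet> w + 2 * h * (w \<bullet> u) + h\<^sup>2 * (u \<bullet> u))) has_real_derivative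
      ((w + t *\<^sub>R u) \<bullet> u / sqrt (w \<bullet> w + 2 * t * (w \<bullet> u) + t\<^sup>2 * (u \<bullet> u)))) (at t within A)"
    by (auto intro!: derivative_eq_intros simp: inner_simps divide_simps)
  then show ?thesis
    by (simp only: eq)
qed

text \<open>The chain rule with the inner denominator cleared: for \<open>f\<close> =
  \<open>x_d\<close> and \<open>c\<close> = \<open>|y|\<close> the result is the kernel
  \<open>|y| / \<rho>^2\<close> of the integrals \<open>k_m\<close>.\<close>

lemma arctan_divide_deriv:
  assumes "(f has_real_derivative D) (at t within A)" "c > 0"
  shows "((\<lambda>t. arctan (f t / c)) has_real_derivative D * c / ((f t)\<^sup>2 + c\<^sup>2)) (at t within A)"
proof -
  have "1 + (f t / c)\<^sup>2 = ((f t)\<^sup>2 + c\<^sup>2) / c\<^sup>2"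
    using assms(2) by (simp add: power_divide add_divide_distrib)
  then have "inverse (1 + (f t / c)\<^sup>2) * (D / c) = D * c / ((f t)\<^sup>2 + c\<^sup>2)"
    using assms(2) by (simp add: power2_eq_square)
  then show ?thesis
    using DERIV_chain2[OF DERIV_arctan DERIV_cdivide[OF assms(1), of c]] by simp
qed

text \<open>The algorithms fix values only for parameters in \<open>I\<close>, so agreement is
  available on the set but not on a neighbourhood; derivatives are therefore transferred within the
  set.\<close>

lemma has_real_derivative_eq_on:
  assumes "(g has_real_derivative D) (at t within A)" "t \<in> A" "\<And>s. s \<in> A \<Longrightarrow> f s = g s" "D = E"
  shows "(f has_real_derivative E) (at t within A)"
  using assms unfolding has_field_derivative_def by (metis has_derivative_transform)


section \<open>The surface divergence of the auxiliary fields\<close>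

lemma frame_components [simp]:
  "ihat $ 1 = 1" "ihat $ 2 = 0" "ihat $ 3 = 0" "jhat $ 1 = 0" "jhat $ 2 = 1" "jhat $ 3 = 0"
  "khat $ 1 = 0" "khat $ 2 = 0" "khat $ 3 = 1"
  by (simp_all add: ihat_def jhat_def khat_def axis_def)

lemma plane_proj_components [simp]:
  "plane_proj p $ 1 = p $ 1" "plane_proj p $ 2 = p $ 2" "plane_proj p $ 3 = 0"
  by (simp_all add: plane_proj_def)

lemma norm_sq_real3: "(norm (x :: real ^ 3))\<^sup>2 = (x $ 1)\<^sup>2 + (x $ 2)\<^sup>2 + (x $ 3)\<^sup>2"
  unfolding power2_norm_eq_inner by (simp add: inner_vec_def sum_3 power2_eq_square)

lemma plane_neq_proj_iff:
  assumes "q $ 3 = 0"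
  shows "q \<noteq> plane_proj p \<longleftrightarrow> (q $ 1 - p $ 1)\<^sup>2 + (q $ 2 - p $ 2)\<^sup>2 > 0"
  using assms by (auto simp: vec_eq_iff forall_3 sum_power2_gt_zero_iff)

lemma plane_neq_proj_imp_neq:
  assumes "q $ 3 = 0" "q \<noteq> plane_proj p"
  shows "q \<noteq> p"
  using assms by (auto simp: vec_eq_iff forall_3)

lemma has_surface_divergence_add:
  assumes "has_surface_divergence m d q" "has_surface_divergence m' d' q"
  shows "has_surface_divergence (\<lambda>q. m q + m' q) (d + d') q"
proof -
  obtain dx dy dx' dy' where
    "((\<lambda>h. m (q + h *\<^sub>R ihat) $ 1) has_real_derivative dx) (at 0)"
    "((\<lambda>h. m (q + h *\<^sub>R jhat) $ 2) has_real_derivative dy) (at 0)"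
    "((\<lambda>h. m' (q + h *\<^sub>R ihat) $ 1) has_real_derivative dx') (at 0)"
    "((\<lambda>h. m' (q + h *\<^sub>R jhat) $ 2) has_real_derivative dy') (at 0)"
    "d = dx + dy" "d' = dx' + dy'"
    using assms unfolding has_surface_divergence_def by blast
  then show ?thesis
    unfolding has_surface_divergence_def
    by (intro exI[of _ "dx + dx'"] exI[of _ "dy + dy'"]) (auto intro!: derivative_eq_intros)
qed

lemma has_surface_divergence_scaleR:
  assumes "has_surface_divergence m d q"
  shows "has_surface_divergence (\<lambda>q. c *\<^sub>R m q) (c * d) q"
proof -
  obtain dx dy where
    "((\<lambda>h. m (q + h *\<^sub>R ihat) $ 1) has_real_derivative dx) (at 0)"
    "((\<lambda>h. m (q + h *\<^sub>R jhat) $ 2) has_real_derivative dy) (at 0)"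
    "d = dx + dy"
    using assms unfolding has_surface_divergence_def by blast
  then show ?thesis
    unfolding has_surface_divergence_def
    by (intro exI[of _ "c * dx"] exI[of _ "c * dy"])
      (auto intro!: derivative_eq_intros simp: algebra_simps)
qed

lemma norm_partial_derivatives:
  assumes "q \<noteq> p"
  shows "((\<lambda>h. norm (q + h *\<^sub>R ihat - p)) has_real_derivative (q $ 1 - p $ 1) / norm (q - p)) (at 0)"
    and "((\<lambda>h. norm (q + h *\<^sub>R jhat - p)) has_real_derivative (q $ 2 - p $ 2) / norm (q - p)) (at 0)"
proof -
  have shift: "q + h *\<^sub>R e - p = (q - p) + h *\<^sub>R e" for h :: real and e
    by simp
  show "((\<lambda>h. norm (q + h *\<^sub>R ihat - p)) has_real_derivative (q $ 1 - p $ 1) / norm (q - p)) (at 0)"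
    "((\<lambda>h. norm (q + h *\<^sub>R jhat - p)) has_real_derivative (q $ 2 - p $ 2) / norm (q - p)) (at 0)"
    unfolding shift
    using has_real_derivative_norm_line[of "q - p" 0 ihat] has_real_derivative_norm_line[of "q - p" 0 jhat] assms
    by (simp_all add: ihat_def jhat_def inner_axis)
qed

text \<open>With \<open>f\<close> = \<open>r\<close> and \<open>D\<close> a component of
  \<open>q - p\<close>, the partial derivative of \<open>r\<close> is \<open>D / r\<close>. The
  exponent cancels the normalisation \<open>a + 1\<close>. The result is kept as
  \<open>r ^ a / (4 * pi * r)\<close>, which avoids a negative exponent at \<open>a = 0\<close> and
  has the shape of the density.\<close>

lemma power_weight_deriv:
  assumes "(f has_real_derivative D / f t) (at t)" "f t > 0"
  shows "((\<lambda>h. f h ^ (a + 1) / (4 * pi * (real a + 1))) has_real_derivative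
           D * (f t ^ a / (4 * pi * f t))) (at t)"
proof -
  have "real a + 1 > 0" by simp
  then have "(real a + 1) * (D / f t * f t ^ a) / (4 * pi * (real a + 1)) = D * (f t ^ a / (4 * pi * f t))"
    using assms(2) by (simp add: divide_simps)
  with DERIV_cdivide[OF DERIV_power_Suc[OF assms(1), of a], of "4 * pi * (real a + 1)"] show ?thesis
    by (simp add: add.commute mult.commute)
qed

text \<open>Exchanging \<open>X\<close> and \<open>Y\<close> changes the sign of the derivative;
  this antisymmetry says that \<open>\<rho> / |\<rho>|^2\<close> is divergence free in the
  plane.\<close>

lemma inverse_sq_kernel_deriv:
  fixes X Y :: real
  assumes "X\<^sup>2 + Y\<^sup>2 > 0"
  shows "((\<lambda>h. (X + h) / ((X + h)\<^sup>2 + Y\<^sup>2)) has_real_derivative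
           (Y\<^sup>2 - X\<^sup>2) / (X\<^sup>2 + Y\<^sup>2)\<^sup>2) (at 0)"
proof -
  have "((\<lambda>h. (X + h) / ((X + h)\<^sup>2 + Y\<^sup>2)) has_real_derivative
      ((X\<^sup>2 + Y\<^sup>2) - X * (2 * X)) / ((X\<^sup>2 + Y\<^sup>2) * (X\<^sup>2 + Y\<^sup>2))) (at 0)"
    using assms by (auto intro!: derivative_eq_intros)
  moreover have "((X\<^sup>2 + Y\<^sup>2) - X * (2 * X)) / ((X\<^sup>2 + Y\<^sup>2) * (X\<^sup>2 + Y\<^sup>2))
      = (Y\<^sup>2 - X\<^sup>2) / (X\<^sup>2 + Y\<^sup>2)\<^sup>2"
    by (simp add: power2_eq_square)
  ultimately show ?thesis by simp
qed

lemma mfield_00_divergence: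
  assumes "q $ 3 = 0" "q \<noteq> plane_proj p"
  shows "has_surface_divergence (mfield p 0 0 a) (norm (q - p) ^ a / (4 * pi * norm (q - p))) q"
proof -
  define X Y D where "X = q $ 1 - p $ 1" and "Y = q $ 2 - p $ 2" and "D = X\<^sup>2 + Y\<^sup>2"
  define R where "R = norm (q - p) ^ a / (4 * pi * norm (q - p))"
  define w where "w v = norm v ^ (a + 1) / (4 * pi * (real a + 1))" for v :: "real ^ 3"
  have D: "D > 0"
    using assms by (simp add: plane_neq_proj_iff D_def X_def Y_def)
  have qp: "q \<noteq> p"
    by (rule plane_neq_proj_imp_neq[OF assms])
  have wx: "((\<lambda>h. w (q + h *\<^sub>R ihat - p)) has_real_derivative X * R) (at 0)"
    using power_weight_deriv[of "\<lambda>h. norm (q + h *\<^sub>R ihat - p)" _ 0 a]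
      norm_partial_derivatives(1)[OF qp] qp by (simp add: w_def X_def R_def)
  have wy: "((\<lambda>h. w (q + h *\<^sub>R jhat - p)) has_real_derivative Y * R) (at 0)"
    using power_weight_deriv[of "\<lambda>h. norm (q + h *\<^sub>R jhat - p)" _ 0 a]
      norm_partial_derivatives(2)[OF qp] qp by (simp add: w_def Y_def R_def)
  have mfield: "mfield p 0 0 a v $ i = w (v - p) * ((v - plane_proj p) $ i / (norm (v - plane_proj p))\<^sup>2)" for v i
    by (simp add: w_def)
  have x: "mfield p 0 0 a (q + h *\<^sub>R ihat) $ 1 = w (q + h *\<^sub>R ihat - p) * ((X + h) / ((X + h)\<^sup>2 + Y\<^sup>2))" for h
  proof -
    have "(norm (q + h *\<^sub>R ihat - plane_proj p))\<^sup>2 = (X + h)\<^sup>2 + Y\<^sup>2"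
      "(q + h *\<^sub>R ihat - plane_proj p) $ 1 = X + h"
      using assms(1) by (simp_all add: norm_sq_real3 X_def Y_def algebra_simps)
    then show ?thesis
      by (simp only: mfield)
  qed
  have y: "mfield p 0 0 a (q + h *\<^sub>R jhat) $ 2 = w (q + h *\<^sub>R jhat - p) * ((Y + h) / ((Y + h)\<^sup>2 + X\<^sup>2))" for h
  proof -
    have "(norm (q + h *\<^sub>R jhat - plane_proj p))\<^sup>2 = (Y + h)\<^sup>2 + X\<^sup>2"
      "(q + h *\<^sub>R jhat - plane_proj p) $ 2 = Y + h"
      using assms(1) by (simp_all add: norm_sq_real3 X_def Y_def algebra_simps)
    then show ?thesis
      by (simp only: mfield)
  qed
  have dx: "((\<lambda>h. mfield p 0 0 a (q + h *\<^sub>R ihat) $ 1) has_real_derivative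
      X * R * (X / D) + (Y\<^sup>2 - X\<^sup>2) / D\<^sup>2 * w (q - p)) (at 0)"
    unfolding x using DERIV_mult[OF wx inverse_sq_kernel_deriv[of X Y]] D by (simp add: D_def)
  have dy: "((\<lambda>h. mfield p 0 0 a (q + h *\<^sub>R jhat) $ 2) has_real_derivative
      Y * R * (Y / D) + (X\<^sup>2 - Y\<^sup>2) / D\<^sup>2 * w (q - p)) (at 0)"
    unfolding y using DERIV_mult[OF wy inverse_sq_kernel_deriv[of Y X]] D by (simp add: D_def add.commute)
  \<comment> \<open>The gradient of the weight is \<open>R\<close> times \<open>(X, Y)\<close>, so
    its product with \<open>(X, Y) / D\<close> is \<open>R\<close>; the two summands containing
    \<open>w (q - p)\<close> cancel.\<close>
  have "R = R * (X\<^sup>2 + Y\<^sup>2) / D"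
    using D by (simp flip: D_def)
  also have "\<dots> = (X * R * (X / D) + (Y\<^sup>2 - X\<^sup>2) / D\<^sup>2 * w (q - p))
      + (Y * R * (Y / D) + (X\<^sup>2 - Y\<^sup>2) / D\<^sup>2 * w (q - p))"
    by (simp add: diff_divide_distrib add_divide_distrib power2_eq_square algebra_simps)
  finally show ?thesis
    unfolding has_surface_divergence_def R_def[symmetric] using dx dy by blast
qed

text \<open>The product rule: one summand comes from the monomial, the other from the weight. Both
  are written as multiples of densities \<open>x^b y^c r^a / (4 * pi * r)\<close>, ready to cancel
  against the other terms of the field recursion.\<close>

lemma source_divergence_ihat:
  assumes "q \<noteq> p"
  shows "has_surface_divergence
      (\<lambda>q. ((q $ 1) ^ b * (q $ 2) ^ c * norm (q - p) ^ (a + 1) / (4 * pi * (real a + 1))) *\<^sub>R ihat)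
      (real b / (real a + 1) * ((q $ 1) ^ (b - 1) * (q $ 2) ^ c * norm (q - p) ^ (a + 2) / (4 * pi * norm (q - p)))
       + (q $ 1 - p $ 1) * ((q $ 1) ^ b * (q $ 2) ^ c * norm (q - p) ^ a / (4 * pi * norm (q - p)))) q"
    (is "has_surface_divergence ?m ?d _")
proof -
  define w where "w h = norm (q + h *\<^sub>R ihat - p) ^ (a + 1) / (4 * pi * (real a + 1))" for h
  have w: "(w has_real_derivative (q $ 1 - p $ 1) * (norm (q - p) ^ a / (4 * pi * norm (q - p)))) (at 0)"
    using power_weight_deriv[of "\<lambda>h. norm (q + h *\<^sub>R ihat - p)" _ 0 a]
      norm_partial_derivatives(1)[OF assms] assms by (simp add: w_def[abs_def])
  \<comment> \<open>\<open>r ^ (a + 1)\<close> is read as \<open>r ^ (a + 2) / r\<close>, the form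
    of a density with index \<open>a + 2\<close>.\<close>
  have w0: "w 0 = norm (q - p) ^ (a + 2) / (4 * pi * norm (q - p)) / (real a + 1)"
    using assms by (simp add: w_def)
  have "((\<lambda>h. (q $ 1 + h) ^ b * (q $ 2) ^ c * w h) has_real_derivative ?d) (at 0)"
    by (auto intro!: derivative_eq_intros w simp: w0 mult_ac)
  moreover have "?m (q + h *\<^sub>R ihat) $ 1 = (q $ 1 + h) ^ b * (q $ 2) ^ c * w h" for h
    by (simp add: w_def)
  moreover have "?m (q + h *\<^sub>R jhat) $ 2 = 0" for h
    by simp
  ultimately show ?thesis
    unfolding has_surface_divergence_def by (intro exI[of _ ?d] exI[of _ 0]) auto
qed

lemma source_divergence_jhat:
  assumes "q \<noteq> p"
  shows "has_surface_divergence
      (\<lambda>q. ((q $ 2) ^ c * norm (q - p) ^ (a + 1) / (4 * pi * (real a + 1))) *\<^sub>R jhat)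
      (real c / (real a + 1) * ((q $ 2) ^ (c - 1) * norm (q - p) ^ (a + 2) / (4 * pi * norm (q - p)))
       + (q $ 2 - p $ 2) * ((q $ 2) ^ c * norm (q - p) ^ a / (4 * pi * norm (q - p)))) q"
    (is "has_surface_divergence ?m ?d _")
proof -
  define w where "w h = norm (q + h *\<^sub>R jhat - p) ^ (a + 1) / (4 * pi * (real a + 1))" for h
  have w: "(w has_real_derivative (q $ 2 - p $ 2) * (norm (q - p) ^ a / (4 * pi * norm (q - p)))) (at 0)"
    using power_weight_deriv[of "\<lambda>h. norm (q + h *\<^sub>R jhat - p)" _ 0 a]
      norm_partial_derivatives(2)[OF assms] assms by (simp add: w_def[abs_def])
  have w0: "w 0 = norm (q - p) ^ (a + 2) / (4 * pi * norm (q - p)) / (real a + 1)"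
    using assms by (simp add: w_def)
  have "((\<lambda>h. (q $ 2 + h) ^ c * w h) has_real_derivative ?d) (at 0)"
    by (auto intro!: derivative_eq_intros w simp: w0 mult_ac)
  moreover have "?m (q + h *\<^sub>R jhat) $ 2 = (q $ 2 + h) ^ c * w h" for h
    by (simp add: w_def)
  moreover have "?m (q + h *\<^sub>R ihat) $ 1 = 0" for h
    by simp
  ultimately show ?thesis
    unfolding has_surface_divergence_def by (intro exI[of _ 0] exI[of _ ?d]) auto
qed

text \<open>The recursion raises \<open>a\<close>, so the induction needs all \<open>a\<close>.\<close>

lemma mfield_divergence:
  assumes q: "q $ 3 = 0" "q \<noteq> plane_proj p"
  shows "has_surface_divergence (mfield p b c a)
      ((q $ 1) ^ b * (q $ 2) ^ c * norm (q - p) ^ a / (4 * pi * norm (q - p))) q"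
proof (induction "b + c" arbitrary: b c a rule: less_induct)
  case less
  \<comment> \<open>Here \<open>A\<close> is the lower density with index \<open>a + 2\<close>,
    \<open>B\<close> the preceding density, \<open>u\<close> a coordinate of \<open>p\<close> and
    \<open>v\<close> the same coordinate of \<open>q\<close>.\<close>
  have cancel: "- k * A + u * B + (k * A + (v - u) * B) = v * B" for k A u B v :: real
    by algebra
  have qp: "q \<noteq> p"
    by (rule plane_neq_proj_imp_neq[OF q])
  consider "b = 0" "c = 0" | c' where "b = 0" "c = Suc c'" | b' where "b = Suc b'"
    by (metis not0_implies_Suc)
  then show ?case
  proof cases
    case 1
    then show ?thesis using mfield_00_divergence[OF q] by simp
  next
    case 2
    have "has_surface_divergence (mfield p 0 (c' - 1) (a + 2))
        ((q $ 2) ^ (c' - 1) * norm (q - p) ^ (a + 2) / (4 * pi * norm (q - p))) q"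
      "has_surface_divergence (mfield p 0 c' a)
        ((q $ 2) ^ c' * norm (q - p) ^ a / (4 * pi * norm (q - p))) q"
      \<comment> \<open>At \<open>c' = 0\<close> the truncated index is 0, still below
        \<open>c\<close>, so the induction hypothesis applies there too.\<close>
      using less[of 0 "c' - 1" "a + 2"] less[of 0 c' a] 2 by simp_all
    from has_surface_divergence_add[OF has_surface_divergence_add[OF
        has_surface_divergence_scaleR[OF this(1), of "- (real c' / (real a + 1))"]
        has_surface_divergence_scaleR[OF this(2), of "p $ 2"]]
        source_divergence_jhat[OF qp, of c' a]]
    show ?thesis
      unfolding 2 mfield.simps(2) [abs_def]
      by (rule back_subst[of "\<lambda>d. has_surface_divergence _ d q"]) (simp only: cancel, simp)
  next
    case 3
    have "has_surface_divergence (mfield p (b' - 1) c (a + 2))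
        ((q $ 1) ^ (b' - 1) * (q $ 2) ^ c * norm (q - p) ^ (a + 2) / (4 * pi * norm (q - p))) q"
      "has_surface_divergence (mfield p b' c a)
        ((q $ 1) ^ b' * (q $ 2) ^ c * norm (q - p) ^ a / (4 * pi * norm (q - p))) q"
      using less[of "b' - 1" c "a + 2"] less[of b' c a] 3 by simp_all
    from has_surface_divergence_add[OF has_surface_divergence_add[OF
        has_surface_divergence_scaleR[OF this(1), of "- (real b' / (real a + 1))"]
        has_surface_divergence_scaleR[OF this(2), of "p $ 1"]]
        source_divergence_ihat[OF qp, of b' c a]]
    show ?thesis
      unfolding 3 mfield.simps(3) [abs_def]
      by (rule back_subst[of "\<lambda>d. has_surface_divergence _ d q"]) (simp only: cancel, simp)
  qed
qed


section \<open>Antiderivatives along the edge line\<close>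

text \<open>The algebraic content of an edge frame: a line in the element plane, a unit direction
  and the orientation of the normal. \<open>edge_line_if_is_edge_frame\<close> supplies it for the
  edges of a triangle.\<close>

locale edge_line =
  fixes F :: edge_frame and p :: "real ^ 3"
  assumes orig3: "orig F $ 3 = 0"
    and iv3: "iv F $ 3 = 0"
    and iv_unit: "(iv F $ 1)\<^sup>2 + (iv F $ 2)\<^sup>2 = 1"
    and jv: "jv F = cross3 khat (iv F)"
    and nv: "nv F = - jv F"
begin

abbreviation "ax \<equiv> iv F $ 1"
abbreviation "ay \<equiv> iv F $ 2"
abbreviation "ah \<equiv> alpha_hat F p"
abbreviation "bh \<equiv> beta_hat F p"
abbreviation "g2 \<equiv> gamma_sq F p"
abbreviation "y \<equiv> ypj F p"
abbreviation "z \<equiv> zpj F p"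
abbreviation "r \<equiv> redge F p"
abbreviation "X \<equiv> xd F p"

section \<open>Coordinates and distances on the edge line\<close>

lemma nv_components: "nv F $ 1 = ay" "nv F $ 2 = - ax" "nv F $ 3 = 0"
  by (simp_all add: nv jv cross3_simps iv3)

lemma zpj_eq: "z = p $ 3"
  by (simp add: zpj_def inner_vec_def sum_3 orig3)

lemma xpj_eq: "xpj F p = (p $ 1 - orig F $ 1) * ax + (p $ 2 - orig F $ 2) * ay"
  by (simp add: xpj_def inner_vec_def sum_3 iv3)

lemma ypj_eq: "y = (p $ 2 - orig F $ 2) * ax - (p $ 1 - orig F $ 1) * ay"
proof -
  have "jv F = - nv F" by (simp add: nv)
  then show ?thesis by (simp add: ypj_def inner_vec_def sum_3 nv_components)
qed

lemma edge_pt_components: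
  "edge_pt F t $ 1 = ax * X t - ah" "edge_pt F t $ 2 = ay * X t - bh" "edge_pt F t $ 3 = 0"
  by (simp_all add: edge_pt_def xd_def alpha_hat_def beta_hat_def orig3 iv3 algebra_simps)

text \<open>In the edge frame the offset from the projection of \<open>p\<close> is
  \<open>x_d\<close> times \<open>iv F\<close> minus \<open>y\<close> times \<open>jv F\<close>,
  where \<open>jv F\<close> has components \<open>(- ay, ax, 0)\<close>.\<close>

lemma edge_offset:
  "edge_pt F t $ 1 - p $ 1 = ax * X t + ay * y" "edge_pt F t $ 2 - p $ 2 = ay * X t - ax * y"
proof -
  have u: "ax * ax + ay * ay = 1" using iv_unit by (simp add: power2_eq_square)
  show "edge_pt F t $ 1 - p $ 1 = ax * X t + ay * y" "edge_pt F t $ 2 - p $ 2 = ay * X t - ax * y"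
    unfolding edge_pt_def xd_def xpj_eq ypj_eq vector_add_component vector_scaleR_component real_scaleR_def
    using u by algebra+
qed

lemma edge_rho_sq: "(norm (edge_pt F t - plane_proj p))\<^sup>2 = (X t)\<^sup>2 + y\<^sup>2"
proof -
  have "(norm (edge_pt F t - plane_proj p))\<^sup>2 = (ax * X t + ay * y)\<^sup>2 + (ay * X t - ax * y)\<^sup>2"
    unfolding norm_sq_real3 by (simp add: edge_offset edge_pt_components(3))
  also have "\<dots> = (X t)\<^sup>2 + y\<^sup>2"
    using iv_unit by algebra
  finally show ?thesis .
qed

lemma redge_sq: "(r t)\<^sup>2 = (X t)\<^sup>2 + g2"
proof -
  have "(r t)\<^sup>2 = (ax * X t + ay * y)\<^sup>2 + (ay * X t - ax * y)\<^sup>2 + z\<^sup>2"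
    unfolding redge_def norm_sq_real3 by (simp add: edge_offset edge_pt_components(3) zpj_eq)
  then show ?thesis
    unfolding gamma_sq_def using iv_unit by algebra
qed

text \<open>The normal is \<open>- jv F\<close>, so only the \<open>jv F\<close> part of the offset
  survives. This constant is the source of the factor \<open>y\<close> in the integrals
  \<open>k_m\<close>.\<close>

lemma edge_rho_nv: "(edge_pt F t - plane_proj p) \<bullet> nv F = y"
proof -
  have "(edge_pt F t - plane_proj p) \<bullet> nv F = (ax * X t + ay * y) * ay - (ay * X t - ax * y) * ax"
    by (simp add: inner_vec_def sum_3 nv_components edge_offset)
  also have "\<dots> = y"
    using iv_unit by algebra
  finally show ?thesis .
qed

lemma gamma_sq_nonneg: "g2 \<ge> 0"
  by (simp add: gamma_sq_def)

lemma redge_ge: "r t \<ge> 0"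
  by (simp add: redge_def)

lemma rho_pos:
  assumes "edge_pt F t \<noteq> plane_proj p"
  shows "(X t)\<^sup>2 + y\<^sup>2 > 0"
  using assms by (simp flip: edge_rho_sq)

lemma redge_pos:
  assumes "edge_pt F t \<noteq> plane_proj p"
  shows "r t > 0"
  using plane_neq_proj_imp_neq[OF edge_pt_components(3) assms] by (simp add: redge_def)

section \<open>Derivatives of the elementary integrals\<close>

lemma xd_deriv: "(X has_real_derivative 1) (at t within I)"
  unfolding xd_def[abs_def] by (auto intro!: derivative_eq_intros)

lemma redge_deriv:
  assumes "edge_pt F t \<noteq> plane_proj p"
  shows "(r has_real_derivative X t / r t) (at t within I)"
proof -
  have shift: "edge_pt F h - p = (orig F - p) + h *\<^sub>R iv F" for h
    by (simp add: edge_pt_def)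
  have "(edge_pt F t - p) \<bullet> iv F = (ax * X t + ay * y) * ax + (ay * X t - ax * y) * ay"
    by (simp add: inner_vec_def sum_3 iv3 edge_offset)
  also have "\<dots> = X t"
    using iv_unit by algebra
  finally show ?thesis
    using has_real_derivative_norm_line[of "orig F - p" t "iv F" I] redge_pos[OF assms]
    unfolding redge_def[abs_def] shift[symmetric] by simp
qed

lemma ln_redge_xd_deriv:
  assumes "edge_pt F t \<noteq> plane_proj p" "g2 > 0"
  shows "((\<lambda>t. ln \<bar>r t + X t\<bar>) has_real_derivative 1 / r t) (at t within I)"
proof -
  \<comment> \<open>Since \<gamma> is nonzero, \<open>|x_d| < r\<close>. This is needed along the
    whole line, so that the absolute value can be removed from the function and not merely at
    \<open>t\<close>.\<close>
  have pos: "r s + X s > 0" for s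
  proof -
    have "\<bar>X s\<bar>\<^sup>2 < (r s)\<^sup>2"
      unfolding redge_sq power2_abs using assms(2) by simp
    then have "\<bar>X s\<bar> < r s"
      using redge_ge by (rule power2_less_imp_less)
    then show ?thesis by linarith
  qed
  have "((\<lambda>t. ln (r t + X t)) has_real_derivative 1 / r t) (at t within I)"
  proof -
    have "1 / (r t + X t) * (X t / r t + 1) = 1 / r t"
      using pos[of t] redge_pos[OF assms(1)] by (simp add: divide_simps)
    then show ?thesis
      using DERIV_chain2[OF DERIV_ln_divide[OF pos] DERIV_add[OF redge_deriv[OF assms(1)] xd_deriv], of I]
      by simp
  qed
  moreover have "\<bar>r s + X s\<bar> = r s + X s" for s
    using pos by (rule abs_of_pos)
  ultimately show ?thesis
    by (simp only:)
qed

text \<open>Since \<open>r\<close> times its derivative is \<open>x_d\<close>, taking the exponent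
  to be at least 2 removes the quotient.\<close>

lemma redge_power_deriv:
  assumes "edge_pt F t \<noteq> plane_proj p"
  shows "((\<lambda>t. r t ^ (m + 2)) has_real_derivative (real m + 2) * (X t * r t ^ m)) (at t within I)"
  using DERIV_power[OF redge_deriv[OF assms], of "m + 2" I] redge_pos[OF assms]
  by (simp add: add.commute)

text \<open>The derivative of \<open>x_d r^(m+2)\<close> is
  \<open>r^(m+2) + (m+2) x_d^2 r^m\<close>. Adding \<open>(m+2) \<gamma>^2 r^m\<close> turns it into
  \<open>(m+3) r^(m+2)\<close>, because \<open>x_d^2 + \<gamma>^2 = r^2\<close>.\<close>

lemma i_int_deriv:
  assumes "edge_pt F t \<noteq> plane_proj p"
  shows "(i_int F p m has_real_derivative r t ^ m) (at t within I)"
proof (induction m rule: induct_nat_012)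
  case 0
  then show ?case
    unfolding i_int.simps(1)[abs_def] by (simp add: xd_deriv)
next
  case 1
  note r = redge_pos[OF assms]
  have "((\<lambda>t. g2 * (1 / 2) * i_minus1 F p t) has_real_derivative g2 * (1 / 2) * (1 / r t)) (at t within I)"
  proof (cases "g2 = 0")
    case False
    with gamma_sq_nonneg have "g2 > 0" by simp
    from DERIV_cmult[OF ln_redge_xd_deriv[OF assms this], of "g2 * (1 / 2)"] show ?thesis
      unfolding i_minus1_def using False by simp
  qed simp
  from DERIV_add[OF this DERIV_cdivide[OF DERIV_mult[OF xd_deriv redge_deriv[OF assms]], of 2]]
  have "((\<lambda>t. g2 * (1 / 2) * i_minus1 F p t + X t * r t / 2) has_real_derivative
      g2 * (1 / 2) * (1 / r t) + (1 * r t + X t / r t * X t) / 2) (at t within I)" .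
  also have "g2 * (1 / 2) * (1 / r t) + (1 * r t + X t / r t * X t) / 2
      = (((X t)\<^sup>2 + g2) / r t + r t) / 2"
    by (simp add: add_divide_distrib power2_eq_square)
  also have "\<dots> = r t ^ 1"
    unfolding redge_sq[symmetric] using r by (simp add: power2_eq_square)
  finally show ?case
    unfolding One_nat_def i_int.simps(2)[abs_def] .
next
  case (ge2 m)
  from DERIV_add[OF DERIV_cmult[OF ge2(1), of "g2 * ((real m + 2) / (real m + 3))"]
      DERIV_cdivide[OF DERIV_mult[OF xd_deriv redge_power_deriv[OF assms, of m]], of "real m + 3"]]
  have "((\<lambda>t. g2 * ((real m + 2) / (real m + 3)) * i_int F p m t + X t * r t ^ (m + 2) / (real m + 3))
      has_real_derivative g2 * ((real m + 2) / (real m + 3)) * r t ^ m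
        + (1 * r t ^ (m + 2) + (real m + 2) * (X t * r t ^ m) * X t) / (real m + 3)) (at t within I)" .
  also have "g2 * ((real m + 2) / (real m + 3)) * r t ^ m
        + (1 * r t ^ (m + 2) + (real m + 2) * (X t * r t ^ m) * X t) / (real m + 3)
      = ((real m + 2) * (((X t)\<^sup>2 + g2) * r t ^ m) + r t ^ (m + 2)) / (real m + 3)"
    by (simp add: add_divide_distrib algebra_simps power2_eq_square)
  also have "((X t)\<^sup>2 + g2) * r t ^ m = r t ^ (m + 2)"
    unfolding redge_sq[symmetric] by (simp add: power2_eq_square)
  also have "((real m + 2) * r t ^ (m + 2) + r t ^ (m + 2)) / (real m + 3) = r t ^ Suc (Suc m)"
  proof -
    have "(real m + 2) * r t ^ (m + 2) + r t ^ (m + 2) = (real m + 3) * r t ^ (m + 2)"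
      by algebra
    then show ?thesis by simp
  qed
  finally show ?case
    unfolding i_int.simps(3)[abs_def] .
qed

text \<open>The recurrence is \<open>r^2 = \<rho>^2 + z^2\<close> multiplied by
  \<open>- y r^m / \<rho>^2\<close>. For \<open>m = 1\<close> the logarithm contributes
  \<open>- y / r\<close> and the arctangent \<open>- y z^2 / (r \<rho>^2)\<close>, which add up to
  \<open>- y r / \<rho>^2\<close>.\<close>

lemma k_int_deriv:
  assumes "edge_pt F t \<noteq> plane_proj p"
  shows "(k_int F p m has_real_derivative - y * r t ^ m / ((X t)\<^sup>2 + y\<^sup>2)) (at t within I)"
proof (cases "y = 0")
  case True
  have "k_int F p m = (\<lambda>_. 0)"
    by (induction m rule: induct_nat_012) (simp_all add: True fun_eq_iff)
  then show ?thesis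
    by (simp add: True)
next
  case False
  note r = redge_pos[OF assms] and dr = redge_deriv[OF assms] and rho = rho_pos[OF assms]
  have r2: "(r t)\<^sup>2 = (X t)\<^sup>2 + y\<^sup>2 + z\<^sup>2"
    using redge_sq[of t] by (simp add: gamma_sq_def)
  show ?thesis
  proof (induction m rule: induct_nat_012)
    case 0
    have "((\<lambda>t. arctan (X t / \<bar>y\<bar>)) has_real_derivative 1 * \<bar>y\<bar> / ((X t)\<^sup>2 + \<bar>y\<bar>\<^sup>2)) (at t within I)"
      using False by (intro arctan_divide_deriv xd_deriv) simp
    from DERIV_cmult[OF this, of "- (y / \<bar>y\<bar>)"] show ?case
      unfolding k_int.simps(1)[abs_def] using False by simp
  next
    case 1
    let ?Q = "(X t)\<^sup>2 + y\<^sup>2"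
    have pos: "g2 > 0"
      using False by (simp add: gamma_sq_def add_pos_nonneg)
    have inner: "((\<lambda>t. z * X t / r t) has_real_derivative z * g2 / r t ^ 3) (at t within I)"
    proof -
      from DERIV_divide[OF DERIV_cmult[OF xd_deriv, of z] dr] r
      have "((\<lambda>t. z * X t / r t) has_real_derivative
          (z * 1 * r t - z * X t * (X t / r t)) / (r t * r t)) (at t within I)"
        by simp
      also have "(z * 1 * r t - z * X t * (X t / r t)) / (r t * r t) = z * ((r t)\<^sup>2 - (X t)\<^sup>2) / r t ^ 3"
        using r by (simp add: divide_simps power2_eq_square power3_eq_cube) (simp add: algebra_simps)
      finally show ?thesis
        by (simp add: redge_sq)
    qed
    have "((\<lambda>t. arctan (z * X t / (\<bar>y\<bar> * r t))) has_real_derivative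
        z * \<bar>y\<bar> / (r t * ?Q)) (at t within I)"
    proof -
      have "((\<lambda>t. arctan (z * X t / r t / \<bar>y\<bar>)) has_real_derivative
          z * g2 / r t ^ 3 * \<bar>y\<bar> / ((z * X t / r t)\<^sup>2 + \<bar>y\<bar>\<^sup>2)) (at t within I)"
        using False by (intro arctan_divide_deriv inner) simp
      also have "(z * X t / r t)\<^sup>2 + \<bar>y\<bar>\<^sup>2 = (z\<^sup>2 * (X t)\<^sup>2 + y\<^sup>2 * (r t)\<^sup>2) / (r t)\<^sup>2"
        using r by (simp add: power_divide power_mult_distrib add_divide_distrib)
      \<comment> \<open>This factorisation lets the \<open>g2\<close> from the derivative of
        \<open>z x_d / r\<close> cancel, leaving \<open>\<rho>^2\<close> in the denominator.\<close>
      also have "z\<^sup>2 * (X t)\<^sup>2 + y\<^sup>2 * (r t)\<^sup>2 = g2 * ?Q"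
        unfolding r2 gamma_sq_def by algebra
      also have "z * g2 / r t ^ 3 * \<bar>y\<bar> / (g2 * ?Q / (r t)\<^sup>2) = z * \<bar>y\<bar> / (r t * ?Q)"
        using r pos by (simp add: power2_eq_square power3_eq_cube)
      finally show ?thesis
        by (simp add: mult.commute)
    qed
    from DERIV_diff[OF DERIV_cmult[OF this, of "- (y / \<bar>y\<bar>) * z"]
        DERIV_cmult[OF ln_redge_xd_deriv[OF assms pos], of y]]
    have "((\<lambda>t. - (y / \<bar>y\<bar>) * z * arctan (z * X t / (\<bar>y\<bar> * r t)) - y * ln \<bar>r t + X t\<bar>)
       has_real_derivative - (y / \<bar>y\<bar>) * z * (z * \<bar>y\<bar> / (r t * ?Q)) - y * (1 / r t)) (at t within I)" .
    also have "- (y / \<bar>y\<bar>) * z * (z * \<bar>y\<bar> / (r t * ?Q)) - y * (1 / r t) = - y * (?Q + z\<^sup>2) / (r t * ?Q)"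
      using False r rho by (simp add: divide_simps) (simp add: algebra_simps power2_eq_square)
    also have "\<dots> = - y * r t ^ Suc 0 / ?Q"
      unfolding r2[symmetric] using r by (simp add: power2_eq_square)
    finally show ?case
      unfolding k_int.simps(2)[abs_def] using False by simp
  next
    case (ge2 m)
    let ?Q = "(X t)\<^sup>2 + y\<^sup>2"
    from DERIV_diff[OF DERIV_cmult[OF ge2(1), of "z\<^sup>2"] DERIV_cmult[OF i_int_deriv[OF assms, of m I], of y]]
    have "((\<lambda>t. z\<^sup>2 * k_int F p m t - y * i_int F p m t) has_real_derivative
       z\<^sup>2 * (- y * r t ^ m / ?Q) - y * r t ^ m) (at t within I)" .
    also have "z\<^sup>2 * (- y * r t ^ m / ?Q) - y * r t ^ m = - y * ((?Q + z\<^sup>2) * r t ^ m) / ?Q"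
      using rho by (simp add: divide_simps) (simp add: algebra_simps)
    also have "\<dots> = - y * r t ^ Suc (Suc m) / ?Q"
      unfolding r2[symmetric] by (simp add: power2_eq_square)
    finally show ?case
      unfolding k_int.simps(3)[abs_def] using False by simp
  qed
qed

section \<open>Correctness of the two algorithms\<close>

text \<open>Every recurrence refers to smaller \<open>b + c\<close>; where it raises
  \<open>a\<close> by 2 it lowers \<open>b + c\<close> by 2, so the range
  \<open>a + b + c \<le> ps\<close> is respected. Hence the induction is on \<open>b + c\<close>
  with \<open>a\<close> arbitrary.\<close>

lemma kappa_deriv:
  assumes alg: "algorithm1 ps F p I \<kappa>"
    and ne: "\<forall>t\<in>I. edge_pt F t \<noteq> plane_proj p" and t: "t \<in> I" and "a + b + c \<le> ps"
  shows "(\<kappa> b c a has_real_derivative (edge_pt F t $ 1) ^ b * (edge_pt F t $ 2) ^ c * r t ^ a) (at t within I)"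
  using \<open>a + b + c \<le> ps\<close>
proof (induction "b + c" arbitrary: b c a rule: less_induct)
  case less
  have t': "edge_pt F t \<noteq> plane_proj p" using ne t by blast
  let ?x = "edge_pt F t $ 1" and ?y = "edge_pt F t $ 2"
  have r2: "r t ^ (a + 2) = r t ^ a * ((X t)\<^sup>2 + g2)" for a
    by (simp only: power_add redge_sq)
  have drp: "((\<lambda>t. r t ^ (a + 2) / (real a + 2)) has_real_derivative X t * r t ^ a) (at t within I)" for a
  proof -
    have "(real a + 2) * (X t * r t ^ a) / (real a + 2) = X t * r t ^ a"
      by simp
    then show ?thesis
      using DERIV_cdivide[OF redge_power_deriv[OF t', of a I], of "real a + 2"] by (simp only:)
  qed
  note IH = less.hyps
  \<comment> \<open>The clauses are extracted for all \<open>s\<close> in \<open>I\<close>, since a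
    derivative within \<open>I\<close> depends on more than the value at \<open>t\<close>.\<close>
  have A: "\<kappa> 0 0 a s = i_int F p a s" if "s \<in> I" "a \<le> ps" for s a
    using alg that unfolding algorithm1_def Let_def by blast
  have A01: "\<kappa> 0 1 a s = ay * (r s ^ (a + 2) / (real a + 2)) - bh * \<kappa> 0 0 a s" if "s \<in> I" "a + 1 \<le> ps" for s a
    using alg that unfolding algorithm1_def Let_def by blast
  have A02: "\<kappa> 0 (c + 2) a s = ay\<^sup>2 * \<kappa> 0 c (a + 2) s - 2 * bh * \<kappa> 0 (c + 1) a s - (bh\<^sup>2 + ay\<^sup>2 * g2) * \<kappa> 0 c a s"
    if "s \<in> I" "a + (c + 2) \<le> ps" for s c a
    using alg that unfolding algorithm1_def Let_def by blast
  have A10: "\<kappa> 1 0 a s = ax * (r s ^ (a + 2) / (real a + 2)) - ah * \<kappa> 0 0 a s" if "s \<in> I" "a + 1 \<le> ps" for s a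
    using alg that unfolding algorithm1_def Let_def by blast
  have A20: "\<kappa> (b + 2) 0 a s = ax\<^sup>2 * \<kappa> b 0 (a + 2) s - 2 * ah * \<kappa> (b + 1) 0 a s - (ah\<^sup>2 + ax\<^sup>2 * g2) * \<kappa> b 0 a s"
    if "s \<in> I" "a + (b + 2) \<le> ps" for s b a
    using alg that unfolding algorithm1_def Let_def by blast
  have A11: "\<kappa> (b + 1) (c + 1) a s = ax * ay * \<kappa> b c (a + 2) s - bh * \<kappa> (b + 1) c a s - ah * \<kappa> b (c + 1) a s
      - (ah * bh + ax * ay * g2) * \<kappa> b c a s"
    if "s \<in> I" "a + (b + 1) + (c + 1) \<le> ps" for s b c a
    using alg that unfolding algorithm1_def Let_def by blast
  consider "b = 0" "c = 0" | "b = 0" "c = 1" | c' where "b = 0" "c = c' + 2" | "b = 1" "c = 0"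
    | b' where "b = b' + 2" "c = 0" | b' c' where "b = b' + 1" "c = c' + 1"
    by (metis Suc_eq_plus1 add_2_eq_Suc' not0_implies_Suc One_nat_def)
  then show ?case
  proof cases
    case 1
    show ?thesis
      by (rule has_real_derivative_eq_on[OF i_int_deriv[OF t', of a I] t])
        (use A less.prems 1 in auto)
  next
    case 2
    have "((\<lambda>t. ay * (r t ^ (a + 2) / (real a + 2)) - bh * \<kappa> 0 0 a t) has_real_derivative
       ay * (X t * r t ^ a) - bh * (?x ^ 0 * ?y ^ 0 * r t ^ a)) (at t within I)"
      using less.prems 2 by (intro DERIV_diff DERIV_cmult drp IH) auto
    then show ?thesis
      by (rule has_real_derivative_eq_on[OF _ t])
        (use A01 less.prems 2 in \<open>auto simp: edge_pt_components algebra_simps\<close>)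
  next
    case 3
    let ?D = "ay\<^sup>2 * (?x ^ 0 * ?y ^ c' * r t ^ (a + 2))
       - 2 * bh * (?x ^ 0 * ?y ^ (c' + 1) * r t ^ a)
       - (bh\<^sup>2 + ay\<^sup>2 * g2) * (?x ^ 0 * ?y ^ c' * r t ^ a)"
    have d: "((\<lambda>t. ay\<^sup>2 * \<kappa> 0 c' (a + 2) t - 2 * bh * \<kappa> 0 (c' + 1) a t - (bh\<^sup>2 + ay\<^sup>2 * g2) * \<kappa> 0 c' a t)
        has_real_derivative ?D) (at t within I)"
      using less.prems 3 by (intro DERIV_diff DERIV_cmult IH) auto
    have "?D = ?y ^ c' * r t ^ a * (ay\<^sup>2 * ((X t)\<^sup>2 + g2) - 2 * bh * ?y - (bh\<^sup>2 + ay\<^sup>2 * g2))"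
      unfolding r2 by (simp add: algebra_simps)
    \<comment> \<open>The \<open>g2\<close> terms cancel, and \<open>ay * X t = ?y + bh\<close>
      leaves \<open>(?y + bh)^2 - 2 * bh * ?y - bh^2\<close>.\<close>
    also have "ay\<^sup>2 * ((X t)\<^sup>2 + g2) - 2 * bh * ?y - (bh\<^sup>2 + ay\<^sup>2 * g2) = ?y\<^sup>2"
      unfolding edge_pt_components by algebra
    finally have "?D = ?x ^ b * ?y ^ c * r t ^ a"
      using 3 by (simp add: power_add power2_eq_square mult_ac)
    then show ?thesis
      using A02 less.prems 3 by (intro has_real_derivative_eq_on[OF d t]) auto
  next
    case 4
    have "((\<lambda>t. ax * (r t ^ (a + 2) / (real a + 2)) - ah * \<kappa> 0 0 a t) has_real_derivative
       ax * (X t * r t ^ a) - ah * (?x ^ 0 * ?y ^ 0 * r t ^ a)) (at t within I)"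
      using less.prems 4 by (intro DERIV_diff DERIV_cmult drp IH) auto
    then show ?thesis
      by (rule has_real_derivative_eq_on[OF _ t])
        (use A10 less.prems 4 in \<open>auto simp: edge_pt_components algebra_simps\<close>)
  next
    case 5
    let ?D = "ax\<^sup>2 * (?x ^ b' * ?y ^ 0 * r t ^ (a + 2))
       - 2 * ah * (?x ^ (b' + 1) * ?y ^ 0 * r t ^ a)
       - (ah\<^sup>2 + ax\<^sup>2 * g2) * (?x ^ b' * ?y ^ 0 * r t ^ a)"
    have d: "((\<lambda>t. ax\<^sup>2 * \<kappa> b' 0 (a + 2) t - 2 * ah * \<kappa> (b' + 1) 0 a t - (ah\<^sup>2 + ax\<^sup>2 * g2) * \<kappa> b' 0 a t)
        has_real_derivative ?D) (at t within I)"
      using less.prems 5 by (intro DERIV_diff DERIV_cmult IH) auto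
    have "?D = ?x ^ b' * r t ^ a * (ax\<^sup>2 * ((X t)\<^sup>2 + g2) - 2 * ah * ?x - (ah\<^sup>2 + ax\<^sup>2 * g2))"
      unfolding r2 by (simp add: algebra_simps)
    also have "ax\<^sup>2 * ((X t)\<^sup>2 + g2) - 2 * ah * ?x - (ah\<^sup>2 + ax\<^sup>2 * g2) = ?x\<^sup>2"
      unfolding edge_pt_components by algebra
    finally have "?D = ?x ^ b * ?y ^ c * r t ^ a"
      using 5 by (simp add: power_add power2_eq_square mult_ac)
    then show ?thesis
      using A20 less.prems 5 by (intro has_real_derivative_eq_on[OF d t]) auto
  next
    case 6
    let ?D = "ax * ay * (?x ^ b' * ?y ^ c' * r t ^ (a + 2))
       - bh * (?x ^ (b' + 1) * ?y ^ c' * r t ^ a)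
       - ah * (?x ^ b' * ?y ^ (c' + 1) * r t ^ a)
       - (ah * bh + ax * ay * g2) * (?x ^ b' * ?y ^ c' * r t ^ a)"
    have d: "((\<lambda>t. ax * ay * \<kappa> b' c' (a + 2) t - bh * \<kappa> (b' + 1) c' a t - ah * \<kappa> b' (c' + 1) a t - (ah * bh + ax * ay * g2) * \<kappa> b' c' a t)
        has_real_derivative ?D) (at t within I)"
      using less.prems 6 by (intro DERIV_diff DERIV_cmult IH) auto
    have "?D = ?x ^ b' * ?y ^ c' * r t ^ a * (ax * ay * ((X t)\<^sup>2 + g2) - bh * ?x - ah * ?y - (ah * bh + ax * ay * g2))"
      unfolding r2 by (simp add: algebra_simps)
    \<comment> \<open>The mixed analogue: expand \<open>(?x + ah) * (?y + bh)\<close>.\<close>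
    also have "ax * ay * ((X t)\<^sup>2 + g2) - bh * ?x - ah * ?y - (ah * bh + ax * ay * g2) = ?x * ?y"
      unfolding edge_pt_components by algebra
    finally have "?D = ?x ^ b * ?y ^ c * r t ^ a"
      using 6 by (simp add: power_add power2_eq_square mult_ac)
    then show ?thesis
      using A11 less.prems 6 by (intro has_real_derivative_eq_on[OF d t]) auto
  qed
qed

text \<open>In the base case \<open>\<rho>\<close> dotted with the normal is the constant
  \<open>y\<close>, so the integrand is a multiple of the derivative of \<open>k_(a+1)\<close>. In
  the recursion the source term carries \<open>r ^ (a + 1)\<close>, hence \<kappa> at index
  \<open>a + 1\<close>, which is still within range.\<close>

lemma xi_deriv:
  assumes alg1: "algorithm1 ps F p I \<kappa>" and alg2: "algorithm2 ps F p I \<kappa> \<xi>"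
    and ne: "\<forall>t\<in>I. edge_pt F t \<noteq> plane_proj p" and t: "t \<in> I" and "a + b + c \<le> ps"
  shows "(\<xi> b c a has_real_derivative mfield p b c a (edge_pt F t) \<bullet> nv F) (at t within I)"
  using \<open>a + b + c \<le> ps\<close>
proof (induction "b + c" arbitrary: b c a rule: less_induct)
  case less
  have t': "edge_pt F t \<noteq> plane_proj p" using ne t by blast
  note IH = less.hyps
  have A00: "\<xi> 0 0 a s = - (k_int F p (a + 1) s / (4 * pi * (real a + 1)))" if "s \<in> I" "a \<le> ps" for s a
    using alg2 that unfolding algorithm2_def by blast
  have A01: "\<xi> 0 (c + 1) a s = - (real c / (real a + 1)) * \<xi> 0 (c - 1) (a + 2) s + p $ 2 * \<xi> 0 c a s
      + (jhat \<bullet> nv F) / (4 * pi * (real a + 1)) * \<kappa> 0 c (a + 1) s"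
    if "s \<in> I" "a + (c + 1) \<le> ps" for s c a
    using alg2 that unfolding algorithm2_def by blast
  have A1: "\<xi> (b + 1) c a s = - (real b / (real a + 1)) * \<xi> (b - 1) c (a + 2) s + p $ 1 * \<xi> b c a s
      + (ihat \<bullet> nv F) / (4 * pi * (real a + 1)) * \<kappa> b c (a + 1) s"
    if "s \<in> I" "a + (b + 1) + c \<le> ps" for s b c a
    using alg2 that unfolding algorithm2_def by blast
  have r: "norm (edge_pt F t - p) = r t" by (simp add: redge_def)
  consider "b = 0" "c = 0" | c' where "b = 0" "c = c' + 1" | b' where "b = b' + 1"
    by (metis Suc_eq_plus1 not0_implies_Suc)
  then show ?case
  proof cases
    case 1
    from DERIV_minus[OF DERIV_cdivide[OF k_int_deriv[OF t', of "a + 1" I], of "4 * pi * (real a + 1)"]]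
    show ?thesis
      by (rule has_real_derivative_eq_on)
        (use A00 less.prems 1 t in \<open>auto simp: edge_rho_nv edge_rho_sq r mult_ac\<close>)
  next
    case 2
    have prev: "((\<lambda>t. - (real c' / (real a + 1)) * \<xi> 0 (c' - 1) (a + 2) t) has_real_derivative
        - (real c' / (real a + 1)) * (mfield p 0 (c' - 1) (a + 2) (edge_pt F t) \<bullet> nv F)) (at t within I)"
    \<comment> \<open>At \<open>c' = 0\<close> the entry with index \<open>a + 2\<close> may lie
      outside the range, where \<xi> is arbitrary; the zero coefficient removes it. The same split
      recurs for \<open>b'\<close>.\<close>
    proof (cases "c' = 0")
      case False
      then show ?thesis using less.prems 2 by (intro DERIV_cmult IH) auto
    qed simp
    have "(\<xi> 0 c' a has_real_derivative mfield p 0 c' a (edge_pt F t) \<bullet> nv F) (at t within I)"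
      using less.prems 2 by (intro IH) auto
    from DERIV_add[OF DERIV_add[OF prev DERIV_cmult[OF this, of "p $ 2"]]
        DERIV_cmult[OF kappa_deriv[OF alg1 ne t, of "a + 1" 0 c'], of "(jhat \<bullet> nv F) / (4 * pi * (real a + 1))"]]
    show ?thesis
      by (rule has_real_derivative_eq_on)
        (use A01 less.prems 2 t in \<open>auto simp: inner_simps r\<close>)
  next
    case 3
    have prev: "((\<lambda>t. - (real b' / (real a + 1)) * \<xi> (b' - 1) c (a + 2) t) has_real_derivative
        - (real b' / (real a + 1)) * (mfield p (b' - 1) c (a + 2) (edge_pt F t) \<bullet> nv F)) (at t within I)"
    proof (cases "b' = 0")
      case False
      then show ?thesis using less.prems 3 by (intro DERIV_cmult IH) auto
    qed simp
    have "(\<xi> b' c a has_real_derivative mfield p b' c a (edge_pt F t) \<bullet> nv F) (at t within I)"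
      using less.prems 3 by (intro IH) auto
    from DERIV_add[OF DERIV_add[OF prev DERIV_cmult[OF this, of "p $ 1"]]
        DERIV_cmult[OF kappa_deriv[OF alg1 ne t, of "a + 1" b' c], of "(ihat \<bullet> nv F) / (4 * pi * (real a + 1))"]]
    show ?thesis
      by (rule has_real_derivative_eq_on)
        (use A1 less.prems 3 t in \<open>auto simp: inner_simps r\<close>)
  qed
qed

end

section \<open>Edges of a triangle and the conclusion\<close>

text \<open>That \<open>iv F\<close> lies in the plane follows from lengths: crossing with
  \<open>khat\<close> discards the third component, yet the result \<open>jv F\<close> is again a
  unit vector.\<close>

lemma edge_line_if_is_edge_frame:
  assumes "is_edge_frame S u w F" "u $ 3 = 0" "w $ 3 = 0"
  shows "edge_line F"
proof -
  have *: "orig F \<in> affine hull {u, w}" "norm (iv F) = 1" "norm (nv F) = 1"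
      "jv F = cross3 khat (iv F)" "jv F = - nv F"
    using assms(1) by (auto simp: is_edge_frame_def outward_unit_normal_def)
  have sum3: "(iv F $ 1)\<^sup>2 + (iv F $ 2)\<^sup>2 + (iv F $ 3)\<^sup>2 = 1"
    using *(2) norm_sq_real3[of "iv F"] by simp
  have "norm (jv F) = 1" using *(3,5) by simp
  then have "(jv F $ 1)\<^sup>2 + (jv F $ 2)\<^sup>2 + (jv F $ 3)\<^sup>2 = 1"
    using norm_sq_real3[of "jv F"] by simp
  then have sum2: "(iv F $ 1)\<^sup>2 + (iv F $ 2)\<^sup>2 = 1"
    unfolding *(4) by (simp add: cross3_simps)
  show ?thesis
  proof
    show "orig F $ 3 = 0" using *(1) assms(2,3) by (auto simp: affine_hull_2)
    show "iv F $ 3 = 0" using sum3 sum2 by simp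
    show "(iv F $ 1)\<^sup>2 + (iv F $ 2)\<^sup>2 = 1" by (fact sum2)
    show "jv F = cross3 khat (iv F)" by (fact *(4))
    show "nv F = - jv F" using *(5) by simp
  qed
qed

theorem theorem4p2:
  fixes ps :: nat
    and v :: "3 \<Rightarrow> real ^ 3" and S :: "(real ^ 3) set" and j :: 3
    and F :: edge_frame and p :: "real ^ 3" and I :: "real set"
    and \<kappa> \<xi> :: "nat \<Rightarrow> nat \<Rightarrow> nat \<Rightarrow> real \<Rightarrow> real"
  assumes "S = convex hull (range v)" and "\<not> collinear (range v)" and "S \<subseteq> element_plane"
    and "is_edge_frame S (v j) (v (j + 1)) F"
    and "is_interval I" and "\<forall>t\<in>I. edge_pt F t \<noteq> plane_proj p"
    and "algorithm1 ps F p I \<kappa>" and "algorithm2 ps F p I \<kappa> \<xi>"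
  shows "\<forall>b c. b + c \<le> ps \<longrightarrow>
    (\<forall>q \<in> element_plane - {plane_proj p}.
       has_surface_divergence (mfield p b c 0)
         ((q $ 1) ^ b * (q $ 2) ^ c / (4 * pi * norm (q - p))) q) \<and>
    (\<forall>t\<in>I. (\<xi> b c 0 has_real_derivative (mfield p b c 0 (edge_pt F t) \<bullet> nv F)) (at t within I))"
proof (intro allI impI conjI ballI)
  fix b c q
  assume "q \<in> element_plane - {plane_proj p}"
  then show "has_surface_divergence (mfield p b c 0)
      ((q $ 1) ^ b * (q $ 2) ^ c / (4 * pi * norm (q - p))) q"
    using mfield_divergence[of q p b c 0] by (simp add: element_plane_def)
next
  fix b c t
  assume bc: "b + c \<le> ps" and t: "t \<in> I"
  \<comment> \<open>The vertices lie in their convex hull and so in the element plane, which puts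
    both end points of the edge at height 0.\<close>
  have "v i \<in> S" for i
    unfolding assms(1) by (simp add: hull_inc)
  then have "v i $ 3 = 0" for i
    using assms(3) by (auto simp: element_plane_def)
  then interpret edge_line F p
    using edge_line_if_is_edge_frame assms(4) by blast
  show "(\<xi> b c 0 has_real_derivative (mfield p b c 0 (edge_pt F t) \<bullet> nv F)) (at t within I)"
    using xi_deriv[OF assms(7,8,6) t] bc by simp
qed

end
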